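(* Let $\mathbf P=(P,\leq,*,1)$ be a strongly sectionally pseudocomplemented poset and $\Theta\in\operatorname{Con}\mathbf P$. Then $[1]\Theta\in\operatorname{Fil}\mathbf P$, and for any $x,y\in P$, $$(x,y)\in\Theta\text{ if and only if }x*y,\,y*x\in[1]\Theta,$$ i.e. $\Phi([1]\Theta)=\Theta$.
   Context: For a poset $(P,\leq)$ and $A\subseteq P$, $U(A)$ and $L(A)$ denote the sets of all upper, respectively lower, bounds of $A$; $U(a,b)=U(\{a,b\})$, $L(b)=L(\{b\})$, $L(U(a,b),c)=L(U(a,b)\cup\{c\})$. The poset is sectionally pseudocomplemented if for all $a,b\in P$ there exists a greatest element $c$ of $P$ with $L(U(a,b),c)=L(b)$; this $c$ is denoted by $a*b$, and one writes $(P,\leq,* )$. A strongly sectionally pseudocomplemented poset is a quadruple $(P,\leq,*,1)$ such that $(P,\leq,* )$ is a sectionally pseudocomplemented poset with greatest element $1$ satisfying $x\leq(x*y)*y$ for all $x,y\in P$. A binary relation $\rho$ on $P$ is $\min$-stable if whenever $(a,b),(c,d)\in\rho$, $a$ is comparable with $c$ and $b$ is comparable with $d$, then $(\min(a,c),\min(b,d))\in\rho$. A congruence on $\mathbf P$ is a $\min$-stable congruence on the algebra $(P,*,1)$; $\operatorname{Con}\mathbf P$ is the set of all of them, and $[1]\Theta$ is the $\Theta$-class of $1$. A filter of $\mathbf P$ is a subset $F$ of $P$ containing $1$ such that for all $x,y,z,v\in P$: (1) if $x*y,y*x\in F$ then $(x*z)*(y*z),(z*x)*(z*y)\in F$; (2)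 if $x*y,y*x,z*v,v*z\in F$, $x$ and $z$ are comparable and $y$ and $v$ are comparable, then $\min(x,z)*\min(y,v)\in F$. $\operatorname{Fil}\mathbf P$ is the set of all filters of $\mathbf P$. For $M\subseteq P$ put $\Phi(M):=\{(x,y)\in P^2\mid x*y,\,y*x\in M\}$. *)

theory Defs
  imports "HOL-Algebra.Order"
begin

locale sectionally_pseudocomplemented_poset = partial_order L for L (structure) +
  fixes imp :: "'a \<Rightarrow> 'a \<Rightarrow> 'a"  (infixl \<open>\<star>\<close> 70)
  assumes imp_greatest:
    "\<lbrakk>a \<in> carrier L; b \<in> carrier L\<rbrakk> \<Longrightarrow>
      greatest L (a \<star> b) {c \<in> carrier L. Lower L (Upper L {a, b} \<union> {c}) = Lower L {b}}"

locale strongly_sectionally_pseudocomplemented_poset =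
  sectionally_pseudocomplemented_poset L imp
  for L (structure) and imp :: "'a \<Rightarrow> 'a \<Rightarrow> 'a"  (infixl \<open>\<star>\<close> 70) +
  fixes one :: 'a
  assumes one_greatest: "greatest L one (carrier L)"
    and strong: "\<lbrakk>x \<in> carrier L; y \<in> carrier L\<rbrakk> \<Longrightarrow> x \<sqsubseteq> (x \<star> y) \<star> y"

definition comparable :: "('a, 'm) gorder_scheme \<Rightarrow> 'a \<Rightarrow> 'a \<Rightarrow> bool"
  where "comparable L x y \<longleftrightarrow> x \<sqsubseteq>\<^bsub>L\<^esub> y \<or> y \<sqsubseteq>\<^bsub>L\<^esub> x"

(* Meaningful only for comparable arguments. *)
definition min_of :: "('a, 'm) gorder_scheme \<Rightarrow> 'a \<Rightarrow> 'a \<Rightarrow> 'a"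
  where "min_of L x y = (if x \<sqsubseteq>\<^bsub>L\<^esub> y then x else y)"

definition min_stable :: "('a, 'm) gorder_scheme \<Rightarrow> ('a \<times> 'a) set \<Rightarrow> bool"
  where "min_stable L \<rho> \<longleftrightarrow>
    (\<forall>a b c d. (a, b) \<in> \<rho> \<and> (c, d) \<in> \<rho> \<and> comparable L a c \<and> comparable L b d \<longrightarrow>
      (min_of L a c, min_of L b d) \<in> \<rho>)"

(* Compatibility with the nullary operation 1 is reflexivity at 1, so 1 is not a parameter. *)
definition Con :: "('a, 'm) gorder_scheme \<Rightarrow> ('a \<Rightarrow> 'a \<Rightarrow> 'a) \<Rightarrow> ('a \<times> 'a) set set"
  where "Con L imp = {\<Theta>. equiv (carrier L) \<Theta> \<and>
    (\<forall>a b c d. (a, b) \<in> \<Theta> \<and> (c, d) \<in> \<Theta> \<longrightarrow> (imp a c, imp b d) \<in> \<Theta>) \<and>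
    min_stable L \<Theta>}"

definition Fil :: "('a, 'm) gorder_scheme \<Rightarrow> ('a \<Rightarrow> 'a \<Rightarrow> 'a) \<Rightarrow> 'a \<Rightarrow> 'a set set"
  where "Fil L imp one = {F. F \<subseteq> carrier L \<and> one \<in> F \<and>
    (\<forall>x\<in>carrier L. \<forall>y\<in>carrier L. \<forall>z\<in>carrier L.
      imp x y \<in> F \<and> imp y x \<in> F \<longrightarrow>
      imp (imp x z) (imp y z) \<in> F \<and> imp (imp z x) (imp z y) \<in> F) \<and>
    (\<forall>x\<in>carrier L. \<forall>y\<in>carrier L. \<forall>z\<in>carrier L. \<forall>v\<in>carrier L.
      imp x y \<in> F \<and> imp y x \<in> F \<and> imp z v \<in> F \<and> imp v z \<in> F \<and>
      comparable L x z \<and> comparable L y v \<longrightarrow>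
      imp (min_of L x z) (min_of L y v) \<in> F)}"

definition Phi :: "('a, 'm) gorder_scheme \<Rightarrow> ('a \<Rightarrow> 'a \<Rightarrow> 'a) \<Rightarrow> 'a set \<Rightarrow> ('a \<times> 'a) set"
  where "Phi L imp M = {(x, y) \<in> carrier L \<times> carrier L. imp x y \<in> M \<and> imp y x \<in> M}"

end

theory Submission
  imports Defs
begin

text \<open>
  The only nontrivial direction is that \<open>x * y, y * x \<in> [1]\<Theta>\<close> implies \<open>(x, y) \<in> \<Theta>\<close>.
  Put \<open>u = (x * y) * y\<close> and \<open>v = (y * x) * x\<close>. Since \<open>1 * z = z\<close>, we have
  \<open>(u, y) \<in> \<Theta>\<close> and \<open>(x, v) \<in> \<Theta>\<close>. By the strong condition and \<open>b \<le> a * b\<close>, both \<open>u\<close> and \<open>v\<close>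
  are upper bounds of \<open>x\<close> and \<open>y\<close>, so min-stability applies to these two pairs, although \<open>x\<close> and
  \<open>y\<close> need not be comparable, and yields \<open>(min u x, min y v) = (x, y)\<close>.
\<close>

lemma min_of_eq_left:
  assumes "x \<sqsubseteq>\<^bsub>L\<^esub> y"
  shows "min_of L x y = x"
  using assms by (simp add: min_of_def)

text \<open>The test in \<open>min_of\<close> favours the first argument, so if
  \<open>x \<sqsubseteq> y\<close> holds as well, antisymmetry has to identify the two.\<close>

lemma (in partial_order) min_of_eq_right:
  assumes "y \<sqsubseteq> x" "x \<in> carrier L" "y \<in> carrier L"
  shows "min_of L x y = y"
  using assms le_antisym[of x y] by (simp add: min_of_def)

context sectionally_pseudocomplemented_poset
begin

lemma imp_closed:
  assumes "a \<in> carrier L" "b \<in> carrier L"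
  shows "a \<star> b \<in> carrier L"
  using imp_greatest[OF assms] by (simp add: greatest_def)

lemma imp_lower:
  assumes "a \<in> carrier L" "b \<in> carrier L"
  shows "Lower L (Upper L {a, b} \<union> {a \<star> b}) = Lower L {b}"
  using imp_greatest[OF assms] by (simp add: greatest_def)

lemma imp_upper:
  assumes "a \<in> carrier L" "b \<in> carrier L" "c \<in> carrier L"
    and "Lower L (Upper L {a, b} \<union> {c}) = Lower L {b}"
  shows "c \<sqsubseteq> a \<star> b"
  using imp_greatest[OF assms(1,2)] assms(3,4) by (auto simp: greatest_def)

text \<open>The element \<open>b\<close> is itself a candidate in the set whose greatest element is
  \<open>a \<star> b\<close>: everything in U(a,b) lies above \<open>b\<close>, so L(U(a,b),b)
  collapses to L(b).\<close>

lemma le_imp: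
  assumes "a \<in> carrier L" "b \<in> carrier L"
  shows "b \<sqsubseteq> a \<star> b"
proof (rule imp_upper[OF assms assms(2)])
  have "l \<sqsubseteq> u" if "l \<in> carrier L" "l \<sqsubseteq> b" "u \<in> Upper L {a, b}" for l u
    using that assms le_trans[of l b u] by (simp add: Upper_def)
  then show "Lower L (Upper L {a, b} \<union> {b}) = Lower L {b}"
    using assms(2) by (simp add: Lower_def) blast
qed

end

context strongly_sectionally_pseudocomplemented_poset
begin

lemma one_closed: "one \<in> carrier L"
  using one_greatest by (simp add: greatest_def)

lemma le_one: "x \<in> carrier L \<Longrightarrow> x \<sqsubseteq> one"
  using one_greatest by (simp add: greatest_def)

text \<open>Since \<open>x\<close> lies in U(x), the lower bounds of U(x) are exactly those of
  \<open>x\<close>, and adjoining \<open>one\<close> imposes no further condition. So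
  \<open>one\<close> is a candidate for \<open>x \<star> x\<close>.\<close>

lemma imp_self:
  assumes "x \<in> carrier L"
  shows "x \<star> x = one"
proof -
  have "l \<sqsubseteq> u" if "l \<in> carrier L" "l \<sqsubseteq> x" "u \<in> Upper L {x}" for l u
    using that assms le_trans[of l x u] by (simp add: Upper_def)
  moreover have "x \<in> Upper L {x}"
    using assms by (simp add: Upper_def)
  ultimately have "Lower L (Upper L {x, x} \<union> {one}) = Lower L {x}"
    using assms one_closed le_one by (simp add: Lower_def) blast
  then have "one \<sqsubseteq> x \<star> x"
    by (rule imp_upper[OF assms assms one_closed])
  then show ?thesis
    using le_one le_antisym imp_closed one_closed assms by blast
qed

text \<open>Every member of U(1,x) lies above \<open>one\<close>, so \<open>one \<star> x\<close>
  belongs to L(U(1,x), 1*x). The defining equation turns this set into L(x), which gives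
  \<open>one \<star> x \<sqsubseteq> x\<close>.\<close>

lemma one_imp:
  assumes "x \<in> carrier L"
  shows "one \<star> x = x"
proof -
  note closed = imp_closed[OF one_closed assms]
  have "one \<star> x \<sqsubseteq> u" if "u \<in> Upper L {one, x}" for u
  proof (rule le_trans[of _ one])
    show "one \<sqsubseteq> u" "u \<in> carrier L"
      using that one_closed by (simp_all add: Upper_def)
  qed (use closed le_one one_closed in simp_all)
  then have "one \<star> x \<in> Lower L (Upper L {one, x} \<union> {one \<star> x})"
    using closed by (simp add: Lower_def)
  then have "one \<star> x \<in> Lower L {x}"
    by (simp only: imp_lower[OF one_closed assms])
  then have "one \<star> x \<sqsubseteq> x"
    using assms by (simp add: Lower_def)
  then show ?thesis
    using le_imp[OF one_closed assms] closed assms by (rule le_antisym)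
qed

lemma congruence_iff:
  assumes "\<Theta> \<in> Con L imp" and x: "x \<in> carrier L" and y: "y \<in> carrier L"
  shows "(x, y) \<in> \<Theta> \<longleftrightarrow> (one, x \<star> y) \<in> \<Theta> \<and> (one, y \<star> x) \<in> \<Theta>"
proof -
  have equiv: "equiv (carrier L) \<Theta>" and min: "min_stable L \<Theta>"
    and compat: "\<And>a b c d. \<lbrakk>(a, b) \<in> \<Theta>; (c, d) \<in> \<Theta>\<rbrakk> \<Longrightarrow> (a \<star> c, b \<star> d) \<in> \<Theta>"
    using assms(1) by (auto simp: Con_def)
  have refl: "\<And>z. z \<in> carrier L \<Longrightarrow> (z, z) \<in> \<Theta>" and
    sym: "\<And>a b. (a, b) \<in> \<Theta> \<Longrightarrow> (b, a) \<in> \<Theta>"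
    using equiv by (auto simp: equiv_def refl_on_def sym_def)
  show ?thesis
  proof
    assume "(x, y) \<in> \<Theta>"
    \<comment> \<open>Multiplying on the left by the reflexive pairs (x,x) and (y,y) makes one side
      x*x or y*y, that is, \<open>one\<close>.\<close>
    then show "(one, x \<star> y) \<in> \<Theta> \<and> (one, y \<star> x) \<in> \<Theta>"
      using compat[of x x x y] compat[of y y y x] refl sym x y by (simp add: imp_self)
  next
    assume *: "(one, x \<star> y) \<in> \<Theta> \<and> (one, y \<star> x) \<in> \<Theta>"
    let ?u = "(x \<star> y) \<star> y" and ?v = "(y \<star> x) \<star> x"
    have u: "?u \<in> carrier L" "x \<sqsubseteq> ?u" and v: "?v \<in> carrier L" "y \<sqsubseteq> ?v"
      using x y strong imp_closed by auto
    \<comment> \<open>The two pairs point in opposite directions on purpose: the first coordinates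
      \<open>?u\<close>, \<open>x\<close> and the second coordinates \<open>y\<close>,
      \<open>?v\<close> are then comparable, with minima \<open>x\<close> and
      \<open>y\<close>.\<close>
    have "(?u, y) \<in> \<Theta>" "(x, ?v) \<in> \<Theta>"
      using * compat[of one "x \<star> y" y y] compat[of one "y \<star> x" x x] refl sym x y
      by (simp_all add: one_imp)
    then have "(min_of L ?u x, min_of L y ?v) \<in> \<Theta>"
      using min u v by (auto simp: min_stable_def comparable_def)
    then show "(x, y) \<in> \<Theta>"
      using u v x by (simp add: min_of_eq_left min_of_eq_right)
  qed
qed

text \<open>By \<open>congruence_iff\<close>, the premises of both filter conditions are statements
  about \<Theta> itself. Compatibility or min-stability then applies inside \<Theta>, and
  \<open>imp_class\<close> carries the result back to the class of \<open>one\<close>.\<close>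

lemma one_class_filter:
  assumes "\<Theta> \<in> Con L imp"
  shows "\<Theta> `` {one} \<in> Fil L imp one"
proof -
  have equiv: "equiv (carrier L) \<Theta>" and min: "min_stable L \<Theta>"
    and compat: "\<And>a b c d. \<lbrakk>(a, b) \<in> \<Theta>; (c, d) \<in> \<Theta>\<rbrakk> \<Longrightarrow> (a \<star> c, b \<star> d) \<in> \<Theta>"
    using assms by (auto simp: Con_def)
  have refl: "\<And>z. z \<in> carrier L \<Longrightarrow> (z, z) \<in> \<Theta>" and sub: "\<Theta> \<subseteq> carrier L \<times> carrier L"
    using equiv by (auto simp: equiv_def refl_on_def)
  note iff = congruence_iff[OF assms]
  have imp_class: "(one, a \<star> b) \<in> \<Theta>" if "(a, b) \<in> \<Theta>" for a b
    using that iff sub by blast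
  show ?thesis
    unfolding Fil_def mem_Collect_eq Image_singleton_iff
  proof (intro conjI ballI impI; (elim conjE)?)
    show "\<Theta> `` {one} \<subseteq> carrier L"
      using sub by auto
    show "(one, one) \<in> \<Theta>"
      by (rule refl[OF one_closed])
  next
    fix x y z
    assume "x \<in> carrier L" "y \<in> carrier L" "z \<in> carrier L"
      and "(one, x \<star> y) \<in> \<Theta>" "(one, y \<star> x) \<in> \<Theta>"
    then have "(x, y) \<in> \<Theta>" "(z, z) \<in> \<Theta>"
      using iff refl by auto
    then show "(one, (x \<star> z) \<star> (y \<star> z)) \<in> \<Theta>" "(one, (z \<star> x) \<star> (z \<star> y)) \<in> \<Theta>"
      by (auto intro: imp_class compat)
  next
    fix x y z v
    assume "x \<in> carrier L" "y \<in> carrier L" "z \<in> carrier L" "v \<in> carrier L"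
      and "(one, x \<star> y) \<in> \<Theta>" "(one, y \<star> x) \<in> \<Theta>" "(one, z \<star> v) \<in> \<Theta>" "(one, v \<star> z) \<in> \<Theta>"
      and comp: "comparable L x z" "comparable L y v"
    then have "(x, y) \<in> \<Theta>" "(z, v) \<in> \<Theta>"
      using iff by auto
    then have "(min_of L x z, min_of L y v) \<in> \<Theta>"
      using min comp unfolding min_stable_def by blast
    then show "(one, min_of L x z \<star> min_of L y v) \<in> \<Theta>"
      by (rule imp_class)
  qed
qed

end

theorem theorem3p7:
  fixes L :: "('a, 'm) gorder_scheme" and imp :: "'a \<Rightarrow> 'a \<Rightarrow> 'a" and one :: 'a
    and \<Theta> :: "('a \<times> 'a) set"
  assumes "strongly_sectionally_pseudocomplemented_poset L imp one"
    and "\<Theta> \<in> Con L imp"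
  shows "\<Theta> `` {one} \<in> Fil L imp one \<and>
    (\<forall>x\<in>carrier L. \<forall>y\<in>carrier L.
      (x, y) \<in> \<Theta> \<longleftrightarrow> imp x y \<in> \<Theta> `` {one} \<and> imp y x \<in> \<Theta> `` {one}) \<and>
    Phi L imp (\<Theta> `` {one}) = \<Theta>"
proof -
  interpret strongly_sectionally_pseudocomplemented_poset L imp one
    by (rule assms(1))
  \<comment> \<open>\<open>Phi\<close> collects only pairs from the carrier, so this inclusion is
    what lets the pointwise equivalence become an equality of relations.\<close>
  have "\<Theta> \<subseteq> carrier L \<times> carrier L"
    using assms(2) by (auto simp: Con_def equiv_def refl_on_def)
  then have "Phi L imp (\<Theta> `` {one}) = \<Theta>"
    using congruence_iff[OF assms(2)] by (auto simp: Phi_def)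
  then show ?thesis
    using one_class_filter[OF assms(2)] congruence_iff[OF assms(2)] by simp
qed

end
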